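(* Let $a<b$ be real numbers and let $n\in\mathbb{N}$, $n\ge 1$. If $f\in\mathcal{C}^{2,2}[a,b]$, then $$\big|R[S_{2n}^{-};f]\big|\leq \frac{1}{2}\,\big|R[S_{n}^{-};f]\big|$$ and $$\big|R[S_{2n}^{-};f]\big|\leq \big|S_{2n}^{-}[f]-S_{n}^{-}[f]\big|.$$
   Context: Write $[a,b]^2=[a,b]\times[a,b]$ and $D^{i,j}f=\frac{\partial^{i+j}f}{\partial x^i\partial y^j}$. Let $C^{2,2}([a,b]^2)$ be the set of functions $f:[a,b]^2\to\mathbb{R}$ such that $D^{i,j}f$ is continuous in $[a,b]^2$ for all $0\le i\le 2$, $0\le j\le 2$, and let $$\mathcal{C}^{2,2}[a,b]=\{f\in C^{2,2}([a,b]^2): D^{2,2}f \text{ does not change sign in } (a,b)^2\}$$ (that is, either $D^{2,2}f\ge 0$ throughout $(a,b)^2$ or $D^{2,2}f\le 0$ throughout $(a,b)^2$). For $n\ge1$ put $h_n=\frac{b-a}{n}$ and $x_{i,n}=y_{i,n}=a+ih_n$, $i=0,\ldots,n$. A primed sum $\sum_{i=0}^{n}{}^{\prime}$ means that the first and the last summands (those with $i=0$ and $i=n$) are halved. The $n$-th composite trapezium rule for a univariate function $g$ on $[a,b]$ and its remainder are $$Q_n^{Tr}[g]=h_n\sum_{i=0}^{n}{}^{\prime}\,g(x_{i,n}),\qquad R[Q_n^{Tr};g]=\int_a^b g(t)\,dt-Q_n^{Tr}[g].$$ The product trapezium cubature rule is $$C_n^{Tr}[f]=h_n^2\sum_{i=0}^{n}{}^{\prime}\sum_{j=0}^{n}{}^{\prime}f(x_{i,n},y_{j,n}).$$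 For $f$ defined on $[a,b]^2$ set $f_v(t)=f\big(\frac{a+b}{2},t\big)$ and $f_h(t)=f\big(t,\frac{a+b}{2}\big)$, $t\in[a,b]$. The modified product trapezoidal rule $S_n^{-}$ is $$S_n^{-}[f]=C_n^{Tr}[f]+(b-a)\Big(R[Q_n^{Tr};f_v]+R[Q_n^{Tr};f_h]\Big),$$ and its remainder is $R[S_n^{-};f]=I[f]-S_n^{-}[f]$, where $I[f]=\iint_{[a,b]^2}f(x,y)\,dx\,dy$. *)

theory Defs
  imports "HOL-Analysis.Analysis"
begin

text \<open>
  Functions on the square are represented by total functions of type
  \<open>real \<times> real \<Rightarrow> real\<close>; only their values on \<open>{a..b} \<times> {a..b}\<close> are ever used.  Accordingly, partial
  derivatives are taken within \<open>{a..b}\<close>, i.e. they are one-sided on the boundary and the usual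
  partial derivatives in the interior.
\<close>

definition partial_x :: "real \<Rightarrow> real \<Rightarrow> (real \<times> real \<Rightarrow> real) \<Rightarrow> real \<times> real \<Rightarrow> real" where
  "partial_x a b f = (\<lambda>(x, y). vector_derivative (\<lambda>t. f (t, y)) (at x within {a..b}))"

definition partial_y :: "real \<Rightarrow> real \<Rightarrow> (real \<times> real \<Rightarrow> real) \<Rightarrow> real \<times> real \<Rightarrow> real" where
  "partial_y a b f = (\<lambda>(x, y). vector_derivative (\<lambda>t. f (x, t)) (at y within {a..b}))"

definition partial_D ::
    "real \<Rightarrow> real \<Rightarrow> nat \<Rightarrow> nat \<Rightarrow> (real \<times> real \<Rightarrow> real) \<Rightarrow> real \<times> real \<Rightarrow> real" where
  "partial_D a b i j f = (partial_x a b ^^ i) ((partial_y a b ^^ j) f)"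

text \<open>
  Since \<open>vector_derivative\<close> is total, existence of the derivatives has to be demanded separately:
  the first two conditions say that each step in the formation of \<open>partial_D a b i j f\<close> for
  \<open>i \<le> r\<close>, \<open>j \<le> s\<close> differentiates a differentiable function.
\<close>

definition C_square :: "nat \<Rightarrow> nat \<Rightarrow> real \<Rightarrow> real \<Rightarrow> (real \<times> real \<Rightarrow> real) set" where
  "C_square r s a b = {f.
     (\<forall>j<s. \<forall>x\<in>{a..b}. \<forall>y\<in>{a..b}.
        (\<lambda>t. partial_D a b 0 j f (x, t)) differentiable (at y within {a..b})) \<and>
     (\<forall>i<r. \<forall>j\<le>s. \<forall>x\<in>{a..b}. \<forall>y\<in>{a..b}.
        (\<lambda>t. partial_D a b i j f (t, y)) differentiable (at x within {a..b})) \<and>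
     (\<forall>i\<le>r. \<forall>j\<le>s. continuous_on ({a..b} \<times> {a..b}) (partial_D a b i j f))}"

definition C22_const_sign :: "real \<Rightarrow> real \<Rightarrow> (real \<times> real \<Rightarrow> real) set" where
  "C22_const_sign a b = {f \<in> C_square 2 2 a b.
     (\<forall>p \<in> {a<..<b} \<times> {a<..<b}. partial_D a b 2 2 f p \<ge> 0) \<or>
     (\<forall>p \<in> {a<..<b} \<times> {a<..<b}. partial_D a b 2 2 f p \<le> 0)}"

definition step :: "real \<Rightarrow> real \<Rightarrow> nat \<Rightarrow> real" where
  "step a b n = (b - a) / real n"

definition node :: "real \<Rightarrow> real \<Rightarrow> nat \<Rightarrow> nat \<Rightarrow> real" where
  "node a b n i = a + real i * step a b n"

definition primed_sum :: "nat \<Rightarrow> (nat \<Rightarrow> real) \<Rightarrow> real" where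
  "primed_sum n g = (\<Sum>i=0..n. if i = 0 \<or> i = n then g i / 2 else g i)"

definition trapezium_rule :: "real \<Rightarrow> real \<Rightarrow> nat \<Rightarrow> (real \<Rightarrow> real) \<Rightarrow> real" where
  "trapezium_rule a b n g = step a b n * primed_sum n (\<lambda>i. g (node a b n i))"

definition trapezium_remainder :: "real \<Rightarrow> real \<Rightarrow> nat \<Rightarrow> (real \<Rightarrow> real) \<Rightarrow> real" where
  "trapezium_remainder a b n g = integral {a..b} g - trapezium_rule a b n g"

definition product_trapezium :: "real \<Rightarrow> real \<Rightarrow> nat \<Rightarrow> (real \<times> real \<Rightarrow> real) \<Rightarrow> real" where
  "product_trapezium a b n f =
     (step a b n)\<^sup>2 * primed_sum n (\<lambda>i. primed_sum n (\<lambda>j. f (node a b n i, node a b n j)))"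

definition modified_trapezium :: "real \<Rightarrow> real \<Rightarrow> nat \<Rightarrow> (real \<times> real \<Rightarrow> real) \<Rightarrow> real" where
  "modified_trapezium a b n f =
     product_trapezium a b n f +
     (b - a) * (trapezium_remainder a b n (\<lambda>t. f ((a + b) / 2, t)) +
                trapezium_remainder a b n (\<lambda>t. f (t, (a + b) / 2)))"

definition modified_remainder :: "real \<Rightarrow> real \<Rightarrow> nat \<Rightarrow> (real \<times> real \<Rightarrow> real) \<Rightarrow> real" where
  "modified_remainder a b n f = integral ({a..b} \<times> {a..b}) f - modified_trapezium a b n f"

end

theory Submission
  imports Defs
begin

text \<open>
  Let \<open>T\<^sub>n = Q\<^sub>n - I\<close> and \<open>P\<^sub>n = I - M\<^sub>n\<close> be the error functionals of the composite trapezium and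
  midpoint rules.  By the Hermite--Hadamard inequality both are nonnegative on convex functions.
  In tensor product notation, \<open>-R[S\<^sub>n] = T\<^sub>n \<otimes> P\<^sub>1 + P\<^sub>1 \<otimes> T\<^sub>n + T\<^sub>n \<otimes> T\<^sub>n\<close>, and \<open>Q\<^sub>2\<^sub>n = (Q\<^sub>n + M\<^sub>n) / 2\<close>
  gives \<open>T\<^sub>n = P\<^sub>n + 2 T\<^sub>2\<^sub>n\<close>.  Hence \<open>2 R[S\<^sub>2\<^sub>n] - R[S\<^sub>n]\<close> is a nonnegative combination of tensor products of
  functionals that are nonnegative on convex functions, and such products are nonnegative on \<open>f\<close>
  when \<open>D\<^sup>2\<^sup>,\<^sup>2 f \<ge> 0\<close>.  The second estimate follows from the first by the triangle inequality.
\<close>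

subsection \<open>Functionals on the interval and their tensor products\<close>

text \<open>The second clause takes the place of boundedness in the sup norm: applying
  \<open>A\<close> in one variable must leave a continuous function of the other, so that an outer
  functional can act on it.\<close>

definition linear_functional :: "real \<Rightarrow> real \<Rightarrow> ((real \<Rightarrow> real) \<Rightarrow> real) \<Rightarrow> bool" where
  "linear_functional a b A \<longleftrightarrow>
     (\<forall>g h c d. continuous_on {a..b} g \<longrightarrow> continuous_on {a..b} h \<longrightarrow>
        A (\<lambda>t. c * g t + d * h t) = c * A g + d * A h) \<and>
     (\<forall>f. continuous_on ({a..b} \<times> {a..b}) f \<longrightarrow> continuous_on {a..b} (\<lambda>x. A (\<lambda>y. f (x, y))))"

definition convex_positive :: "real \<Rightarrow> real \<Rightarrow> ((real \<Rightarrow> real) \<Rightarrow> real) \<Rightarrow> bool" where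
  "convex_positive a b A \<longleftrightarrow>
     linear_functional a b A \<and> (\<forall>g. continuous_on {a..b} g \<longrightarrow> convex_on {a..b} g \<longrightarrow> 0 \<le> A g)"

definition tensor ::
    "((real \<Rightarrow> real) \<Rightarrow> real) \<Rightarrow> ((real \<Rightarrow> real) \<Rightarrow> real) \<Rightarrow> (real \<times> real \<Rightarrow> real) \<Rightarrow> real" where
  "tensor A B f = A (\<lambda>x. B (\<lambda>y. f (x, y)))"

text \<open>A derivative-free form of \<open>D\<^sup>2\<^sup>,\<^sup>2 f \<ge> 0\<close>.\<close>

definition biconvex :: "real \<Rightarrow> real \<Rightarrow> (real \<times> real \<Rightarrow> real) \<Rightarrow> bool" where
  "biconvex a b f \<longleftrightarrow>
     (\<forall>x\<in>{a..b}. \<forall>z\<in>{a..b}. \<forall>u\<ge>0. \<forall>v\<ge>0. u + v = 1 \<longrightarrow>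
        convex_on {a..b} (\<lambda>y. u * f (x, y) + v * f (z, y) - f (u * x + v * z, y)))"

lemma linear_functionalD:
  assumes "linear_functional a b A" "continuous_on {a..b} g" "continuous_on {a..b} h"
  shows "A (\<lambda>t. c * g t + d * h t) = c * A g + d * A h"
  using assms unfolding linear_functional_def by blast

lemma linear_functional_scale:
  assumes "linear_functional a b A" "continuous_on {a..b} g"
  shows "A (\<lambda>t. c * g t) = c * A g"
  using linear_functionalD[OF assms assms(2), of c 0] by simp

lemma linear_functional_continuous:
  assumes "linear_functional a b A" "continuous_on ({a..b} \<times> {a..b}) f"
  shows "continuous_on {a..b} (\<lambda>x. A (\<lambda>y. f (x, y)))"
  using assms unfolding linear_functional_def by blast

lemma continuous_on_sections:
  fixes f :: "'a::topological_space \<times> 'b::topological_space \<Rightarrow> 'c::topological_space"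
  assumes "continuous_on (S \<times> T) f"
  shows "x \<in> S \<Longrightarrow> continuous_on T (\<lambda>y. f (x, y))" "y \<in> T \<Longrightarrow> continuous_on S (\<lambda>x. f (x, y))"
  by (auto intro!: continuous_on_compose2[OF assms] continuous_intros)

lemma linear_functional_lincomb:
  assumes "linear_functional a b A" "linear_functional a b B"
  shows "linear_functional a b (\<lambda>g. c * A g + d * B g)"
  unfolding linear_functional_def
proof (intro conjI allI impI)
  fix g h :: "real \<Rightarrow> real" and p q
  assume gh: "continuous_on {a..b} g" "continuous_on {a..b} h"
  show "c * A (\<lambda>t. p * g t + q * h t) + d * B (\<lambda>t. p * g t + q * h t) =
        p * (c * A g + d * B g) + q * (c * A h + d * B h)"
    using linear_functionalD[OF assms(1) gh] linear_functionalD[OF assms(2) gh]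
    by (simp add: algebra_simps)
next
  fix f :: "real \<times> real \<Rightarrow> real"
  assume f: "continuous_on ({a..b} \<times> {a..b}) f"
  show "continuous_on {a..b} (\<lambda>x. c * A (\<lambda>y. f (x, y)) + d * B (\<lambda>y. f (x, y)))"
    by (intro continuous_intros linear_functional_continuous assms f)
qed

lemma linear_functional_eval:
  assumes "x \<in> {a..b}"
  shows "linear_functional a b (\<lambda>g. g x)"
  using assms unfolding linear_functional_def by (auto intro: continuous_on_sections)

lemma linear_functional_zero: "linear_functional a b (\<lambda>g. 0)"
  unfolding linear_functional_def by simp

lemma linear_functional_sum:
  assumes "\<And>i. i \<in> S \<Longrightarrow> linear_functional a b (A i)"
  shows "linear_functional a b (\<lambda>g. \<Sum>i\<in>S. w * A i g)"
  using assms
proof (induction S rule: infinite_finite_induct)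
  case (insert i S)
  then show ?case
    using linear_functional_lincomb[of a b "A i" "\<lambda>g. \<Sum>i\<in>S. w * A i g" w 1] by simp
qed (auto simp: linear_functional_zero)

lemma linear_functional_integral: "linear_functional a b (integral {a..b})"
  unfolding linear_functional_def
proof (intro conjI allI impI)
  fix g h :: "real \<Rightarrow> real" and c d
  assume "continuous_on {a..b} g" "continuous_on {a..b} h"
  then have "g integrable_on {a..b}" "h integrable_on {a..b}"
    by (auto intro: integrable_continuous_real)
  then show "integral {a..b} (\<lambda>t. c * g t + d * h t) = c * integral {a..b} g + d * integral {a..b} h"
    by (subst integral_add) (auto intro: integrable_cmul[where 'b = real, simplified])
next
  fix f :: "real \<times> real \<Rightarrow> real"
  assume "continuous_on ({a..b} \<times> {a..b}) f"
  then show "continuous_on {a..b} (\<lambda>x. integral {a..b} (\<lambda>y. f (x, y)))"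
    using integral_continuous_on_param[of "{a..b}" a b "\<lambda>x y. f (x, y)"] by simp
qed

section \<open>Bilinearity and positivity of tensor products\<close>

lemma tensor_lincomb_left:
  "tensor (\<lambda>g. c * A g + d * B g) C f = c * tensor A C f + d * tensor B C f"
  by (simp add: tensor_def)

text \<open>Unlike on the left, the combination sits inside the outer functional, so linearity of
  \<open>A\<close> is applied to the inner results, which are continuous by the second clause of
  \<open>linear_functional\<close>.\<close>

lemma tensor_lincomb_right:
  assumes "linear_functional a b A" "linear_functional a b B" "linear_functional a b C"
    and "continuous_on ({a..b} \<times> {a..b}) f"
  shows "tensor A (\<lambda>g. c * B g + d * C g) f = c * tensor A B f + d * tensor A C f"
  unfolding tensor_def
  by (intro linear_functionalD[OF assms(1)] linear_functional_continuous assms)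

text \<open>For fixed \<open>x\<close>, \<open>z\<close>, \<open>u\<close>, \<open>v\<close> the
  convexity defect of \<open>f\<close> in its first variable is convex in \<open>y\<close> by
  \<open>biconvex\<close>, so \<open>B\<close> is nonnegative on it. By linearity this says that
  applying \<open>B\<close> in \<open>y\<close> gives a convex function of \<open>x\<close>, on
  which \<open>A\<close> is nonnegative.\<close>

lemma tensor_nonneg:
  assumes A: "convex_positive a b A" and B: "convex_positive a b B"
    and f: "continuous_on ({a..b} \<times> {a..b}) f" "biconvex a b f"
  shows "0 \<le> tensor A B f"
proof -
  have linB: "linear_functional a b B"
    using B unfolding convex_positive_def by blast
  have "convex_on {a..b} (\<lambda>x. B (\<lambda>y. f (x, y)))"
    unfolding convex_on_def
  proof (intro conjI ballI allI impI)
    fix x z u v :: real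
    assume xz: "x \<in> {a..b}" "z \<in> {a..b}" and uv: "0 \<le> u" "0 \<le> v" "u + v = 1"
    have m: "u * x + v * z \<in> {a..b}"
      using convexD[OF convex_real_interval(5) xz uv] by simp
    note cont = continuous_on_sections(1)[OF f(1)]
    have "continuous_on {a..b} (\<lambda>y. u * f (x, y) + v * f (z, y) - f (u * x + v * z, y))"
      by (intro continuous_intros cont xz m)
    moreover have "convex_on {a..b} (\<lambda>y. u * f (x, y) + v * f (z, y) - f (u * x + v * z, y))"
      using f(2) xz uv unfolding biconvex_def by blast
    ultimately have "0 \<le> B (\<lambda>y. u * f (x, y) + v * f (z, y) - f (u * x + v * z, y))"
      using B unfolding convex_positive_def by blast
    also have "\<dots> = B (\<lambda>y. 1 * (u * f (x, y) + v * f (z, y)) + (-1) * f (u * x + v * z, y))"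
      by simp
    also have "\<dots> = 1 * B (\<lambda>y. u * f (x, y) + v * f (z, y)) + (-1) * B (\<lambda>y. f (u * x + v * z, y))"
      by (intro linear_functionalD[OF linB] continuous_intros cont xz m)
    also have "B (\<lambda>y. u * f (x, y) + v * f (z, y)) = u * B (\<lambda>y. f (x, y)) + v * B (\<lambda>y. f (z, y))"
      by (intro linear_functionalD[OF linB] cont xz)
    finally show "B (\<lambda>y. f (u *\<^sub>R x + v *\<^sub>R z, y)) \<le> u * B (\<lambda>y. f (x, y)) + v * B (\<lambda>y. f (z, y))"
      by simp
  qed simp
  then show ?thesis
    using A linear_functional_continuous[OF linB f(1)]
    unfolding convex_positive_def tensor_def by blast
qed

subsection \<open>Trapezium and midpoint rules on convex functions\<close>

definition midpoint_rule :: "real \<Rightarrow> real \<Rightarrow> nat \<Rightarrow> (real \<Rightarrow> real) \<Rightarrow> real" where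
  "midpoint_rule a b n g = step a b n * (\<Sum>i<n. g ((node a b n i + node a b n (Suc i)) / 2))"

text \<open>Regroups the sum by panels, to which the estimates on single intervals apply. At
  \<open>n = 0\<close> the sole summand is first and last at once and is halved only once, so the
  left side would be \<open>g 0 / 2\<close> and the right side 0.\<close>

lemma primed_sum_eq:
  assumes "n \<ge> 1"
  shows "primed_sum n g = (\<Sum>i<n. (g i + g (Suc i)) / 2)"
proof -
  have "primed_sum n g =
      (\<Sum>i\<le>n. g i - (if i = 0 then g 0 / 2 else 0) - (if i = n then g n / 2 else 0))"
    unfolding primed_sum_def atLeast0AtMost using assms by (intro sum.cong) auto
  also have "\<dots> = (\<Sum>i\<le>n. g i) - g 0 / 2 - g n / 2"
    by (simp add: sum_subtractf)
  also have "\<dots> = (\<Sum>i<n. (g i + g (Suc i)) / 2)"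
    by (induction n) (auto simp: field_simps)
  finally show ?thesis .
qed

lemma primed_sum_scale: "primed_sum n (\<lambda>i. c * g i) = c * primed_sum n g"
  unfolding primed_sum_def sum_distrib_left by (intro sum.cong) auto

lemma trapezium_rule_eq:
  assumes "n \<ge> 1"
  shows "trapezium_rule a b n g =
    (\<Sum>i<n. step a b n * (g (node a b n i) + g (node a b n (Suc i))) / 2)"
  using assms by (simp add: trapezium_rule_def primed_sum_eq sum_distrib_left)

text \<open>Halving the step keeps the old nodes at even indices and puts the panel midpoints at odd
  indices.\<close>

lemma trapezium_rule_double:
  assumes "n \<ge> 1"
  shows "trapezium_rule a b (2 * n) g = (trapezium_rule a b n g + midpoint_rule a b n g) / 2"
proof -
  define F where "F i = step a b (2 * n) * (g (node a b (2 * n) i) + g (node a b (2 * n) (Suc i))) / 2" for i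
  have s: "step a b (2 * n) = step a b n / 2"
    by (simp add: step_def)
  have e: "node a b (2 * n) (2 * i) = node a b n i" for i
    by (simp add: node_def s)
  have e2: "node a b (2 * n) (Suc (Suc (2 * i))) = node a b n (Suc i)" for i
    using e[of "Suc i"] by simp
  have o: "node a b (2 * n) (Suc (2 * i)) = (node a b n i + node a b n (Suc i)) / 2" for i
    unfolding node_def s by (simp add: algebra_simps)
  \<comment> \<open>Two consecutive fine panels make up one coarse panel.\<close>
  have "(\<Sum>i<2*m. F i) = (\<Sum>i<m. F (2 * i) + F (Suc (2 * i)))" for m
    by (induction m) auto
  then have "trapezium_rule a b (2 * n) g = (\<Sum>i<n. F (2 * i) + F (Suc (2 * i)))"
    using trapezium_rule_eq[of "2 * n" a b g] assms by (simp add: F_def)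
  also have "\<dots> = (trapezium_rule a b n g + midpoint_rule a b n g) / 2"
    unfolding trapezium_rule_eq[OF assms] midpoint_rule_def F_def e o e2 s
    by (simp add: sum_distrib_left sum_divide_distrib flip: sum.distrib)
       (intro sum.cong, auto simp: field_simps)
  finally show ?thesis .
qed

section \<open>The Hermite-Hadamard inequality on one interval\<close>

lemma trapezoid_convex:
  fixes g :: "real \<Rightarrow> real"
  assumes "c \<le> d" "continuous_on {c..d} g" "convex_on {c..d} g"
  shows "integral {c..d} g \<le> (d - c) * (g c + g d) / 2"
proof -
  \<comment> \<open>Slope of the chord, which lies above the graph of \<open>g\<close> and whose
    integral is the trapezium value. If \<open>c = d\<close>, then \<open>k = 0\<close> by division
    by zero and both sides of the claim vanish.\<close>
  define k where "k = (g d - g c) / (d - c)"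
  have lin: "((\<lambda>t. k * (t - c) + g c) has_integral (d - c) * (g c + g d) / 2) {c..d}"
  proof -
    have "((\<lambda>t. k * (t - c) + g c) has_integral
        (k * (d - c)^2 / 2 + g c * d) - (k * (c - c)^2 / 2 + g c * c)) {c..d}"
      by (rule fundamental_theorem_of_calculus[OF assms(1)])
         (auto intro!: derivative_eq_intros simp flip: has_real_derivative_iff_has_vector_derivative)
    moreover have "(k * (d - c)^2 / 2 + g c * d) - (k * (c - c)^2 / 2 + g c * c) =
        (d - c) * (g c + g d) / 2"
      by (cases "c = d") (auto simp: k_def field_simps power2_eq_square)
    ultimately show ?thesis by metis
  qed
  have "integral {c..d} g \<le> integral {c..d} (\<lambda>t. k * (t - c) + g c)"
    using convex_onD_Icc'[OF assms(3)] assms(2) lin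
    by (intro integral_le) (auto simp: k_def intro: integrable_continuous_real)
  also have "\<dots> = (d - c) * (g c + g d) / 2"
    using lin by (rule integral_unique)
  finally show ?thesis .
qed

text \<open>Reflection about the midpoint preserves the integral, and by convexity the average of
  \<open>g\<close> and its reflection is nowhere below \<open>g ((c + d) / 2)\<close>. This makes a
  supporting line unnecessary.\<close>

lemma midpoint_convex:
  fixes g :: "real \<Rightarrow> real"
  assumes "c \<le> d" and g: "continuous_on {c..d} g" "convex_on {c..d} g"
  shows "(d - c) * g ((c + d) / 2) \<le> integral {c..d} g"
proof -
  let ?r = "\<lambda>t. g (c + d - t)"
  have r: "continuous_on {c..d} ?r"
    by (intro continuous_on_compose2[OF g(1)] continuous_intros) auto
  \<comment> \<open>The reflection is a change of sign followed by a shift by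
    \<open>c + d\<close>.\<close>
  have "integral {c..d} ?r = integral {-d..-c} (\<lambda>s. g (c + d + s))"
    using Henstock_Kurzweil_Integration.integral_reflect_real[of "-c" "-d" "\<lambda>s. g (c + d + s)"] by simp
  also have "\<dots> = integral {c..d} g"
    using integral_shift_Icc_real[of "-d" "-c" g "c + d"] by (simp add: o_def)
  finally have refl: "integral {c..d} ?r = integral {c..d} g" .
  have "(d - c) * g ((c + d) / 2) = integral {c..d} (\<lambda>t. g ((c + d) / 2))"
    using assms by simp
  also have "\<dots> \<le> integral {c..d} (\<lambda>t. (g t + ?r t) / 2)"
  proof (intro integral_le integrable_continuous_real continuous_intros g r)
    fix t assume t: "t \<in> {c..d}"
    have "g ((1 / 2) *\<^sub>R t + (1 / 2) *\<^sub>R (c + d - t)) \<le> 1 / 2 * g t + 1 / 2 * g (c + d - t)"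
      using t by (intro g(2)[unfolded convex_on_def, THEN conjunct2, rule_format]) auto
    moreover have "(1 / 2) *\<^sub>R t + (1 / 2) *\<^sub>R (c + d - t) = (c + d) / 2"
      by (simp add: field_simps)
    ultimately show "g ((c + d) / 2) \<le> (g t + ?r t) / 2"
      by (metis add_divide_distrib mult_1 times_divide_eq_left)
  qed auto
  also have "\<dots> = (integral {c..d} g + integral {c..d} ?r) / 2"
    using g(1) r by (simp add: integral_add integrable_continuous_real)
  finally show ?thesis
    using refl by simp
qed

section \<open>Panels of the equidistant partition\<close>

lemma node_bounds:
  assumes "a \<le> b" "n \<ge> 1" "i \<le> n"
  shows "node a b n i \<in> {a..b}"
proof -
  have "real i * step a b n \<le> real n * step a b n"
    using assms by (intro mult_right_mono) (auto simp: step_def)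
  also have "\<dots> = b - a"
    using assms by (simp add: step_def)
  finally show ?thesis
    using assms by (auto simp: node_def step_def)
qed

lemma node_diff: "node a b n (Suc i) - node a b n i = step a b n"
  by (simp add: node_def algebra_simps)

lemma node_mono:
  assumes "a \<le> b"
  shows "node a b n i \<le> node a b n (Suc i)"
  using node_diff[of a b n i] assms unfolding step_def
  by (smt (verit) divide_nonneg_nonneg of_nat_0_le_iff)

lemma integral_nodes:
  fixes g :: "real \<Rightarrow> real"
  assumes "a \<le> b" "n \<ge> 1" "continuous_on {a..b} g"
  shows "integral {a..b} g = (\<Sum>i<n. integral {node a b n i..node a b n (Suc i)} g)"
proof -
  have "k \<le> n \<Longrightarrow> integral {a..node a b n k} g =
      (\<Sum>i<k. integral {node a b n i..node a b n (Suc i)} g)" for k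
  proof (induction k)
    case 0
    then show ?case by (simp add: node_def)
  next
    case (Suc k)
    have b: "node a b n k \<in> {a..b}" "node a b n (Suc k) \<in> {a..b}"
      using node_bounds[of a b n k] node_bounds[of a b n "Suc k"] assms Suc.prems by auto
    have "g integrable_on {a..node a b n (Suc k)}"
      by (intro integrable_continuous_real continuous_on_subset[OF assms(3)]) (use b in auto)
    then have "integral {a..node a b n (Suc k)} g =
        integral {a..node a b n k} g + integral {node a b n k..node a b n (Suc k)} g"
      using b node_mono[OF assms(1), of n k] by (simp add: Henstock_Kurzweil_Integration.integral_combine)
    then show ?case using Suc by simp
  qed
  from this[of n] show ?thesis
    using assms by (simp add: node_def step_def)
qed

section \<open>Error functionals of the composite rules\<close>

lemma linear_functional_trapezium:
  assumes "a \<le> b" "n \<ge> 1"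
  shows "linear_functional a b (trapezium_rule a b n)"
proof -
  have "linear_functional a b (\<lambda>g. step a b n / 2 * g (node a b n i) + step a b n / 2 * g (node a b n (Suc i)))"
    if "i < n" for i
    using node_bounds[OF assms, of i] node_bounds[OF assms, of "Suc i"] that
    by (intro linear_functional_lincomb linear_functional_eval) auto
  \<comment> \<open>The factor 1 is the common weight \<open>w\<close> in
    \<open>linear_functional_sum\<close>; the step size already sits in the panel terms.\<close>
  then have "linear_functional a b (\<lambda>g. \<Sum>i<n. 1 *
      (step a b n / 2 * g (node a b n i) + step a b n / 2 * g (node a b n (Suc i))))"
    by (intro linear_functional_sum) auto
  moreover have "trapezium_rule a b n = (\<lambda>g. \<Sum>i<n. 1 *
      (step a b n / 2 * g (node a b n i) + step a b n / 2 * g (node a b n (Suc i))))"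
    using trapezium_rule_eq[OF assms(2)] by (auto simp: fun_eq_iff algebra_simps add_divide_distrib)
  ultimately show ?thesis by simp
qed

lemma linear_functional_midpoint:
  assumes "a \<le> b" "n \<ge> 1"
  shows "linear_functional a b (midpoint_rule a b n)"
proof -
  have "(node a b n i + node a b n (Suc i)) / 2 \<in> {a..b}" if "i < n" for i
    using node_bounds[OF assms, of i] node_bounds[OF assms, of "Suc i"] that by auto
  then have "linear_functional a b
      (\<lambda>g. \<Sum>i<n. step a b n * g ((node a b n i + node a b n (Suc i)) / 2))"
    by (intro linear_functional_sum linear_functional_eval) auto
  then show ?thesis
    unfolding midpoint_rule_def sum_distrib_left .
qed

text \<open>Sums \<open>trapezoid_convex\<close> over the panels. The coefficients 1 and -1 are kept
  explicit so that the error has the shape of \<open>linear_functional_lincomb\<close> and of the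
  tensor lemmas.\<close>

lemma convex_positive_trapezium:
  assumes "a \<le> b" "n \<ge> 1"
  shows "convex_positive a b (\<lambda>g. 1 * trapezium_rule a b n g + (-1) * integral {a..b} g)"
  unfolding convex_positive_def
proof (intro conjI allI impI linear_functional_lincomb linear_functional_trapezium
    linear_functional_integral assms)
  fix g assume g: "continuous_on {a..b} g" "convex_on {a..b} g"
  have "integral {node a b n i..node a b n (Suc i)} g \<le>
      step a b n * (g (node a b n i) + g (node a b n (Suc i))) / 2" if "i < n" for i
  proof -
    have "{node a b n i..node a b n (Suc i)} \<subseteq> {a..b}"
      using node_bounds[OF assms, of i] node_bounds[OF assms, of "Suc i"] that by auto
    then have "continuous_on {node a b n i..node a b n (Suc i)} g"
      "convex_on {node a b n i..node a b n (Suc i)} g"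
      using g by (auto intro: continuous_on_subset convex_on_subset simp del: atLeastatMost_subset_iff)
    from trapezoid_convex[OF node_mono[OF assms(1)] this] show ?thesis
      by (simp add: node_diff)
  qed
  then have "integral {a..b} g \<le> trapezium_rule a b n g"
    unfolding integral_nodes[OF assms g(1)] trapezium_rule_eq[OF assms(2)]
    by (intro sum_mono) auto
  then show "0 \<le> 1 * trapezium_rule a b n g + (-1) * integral {a..b} g"
    by simp
qed

lemma convex_positive_midpoint:
  assumes "a \<le> b" "n \<ge> 1"
  shows "convex_positive a b (\<lambda>g. 1 * integral {a..b} g + (-1) * midpoint_rule a b n g)"
  unfolding convex_positive_def
proof (intro conjI allI impI linear_functional_lincomb linear_functional_midpoint
    linear_functional_integral assms)
  fix g assume g: "continuous_on {a..b} g" "convex_on {a..b} g"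
  have "step a b n * g ((node a b n i + node a b n (Suc i)) / 2) \<le>
      integral {node a b n i..node a b n (Suc i)} g" if "i < n" for i
  proof -
    have "{node a b n i..node a b n (Suc i)} \<subseteq> {a..b}"
      using node_bounds[OF assms, of i] node_bounds[OF assms, of "Suc i"] that by auto
    then have "continuous_on {node a b n i..node a b n (Suc i)} g"
      "convex_on {node a b n i..node a b n (Suc i)} g"
      using g by (auto intro: continuous_on_subset convex_on_subset simp del: atLeastatMost_subset_iff)
    from midpoint_convex[OF node_mono[OF assms(1)] this] show ?thesis
      by (simp add: node_diff)
  qed
  then have "midpoint_rule a b n g \<le> integral {a..b} g"
    unfolding integral_nodes[OF assms g(1)] midpoint_rule_def sum_distrib_left
    by (intro sum_mono) auto
  then show "0 \<le> 1 * integral {a..b} g + (-1) * midpoint_rule a b n g"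
    by simp
qed

subsection \<open>Sign of the mixed derivative\<close>

text \<open>The sign of the second derivative is known only in the open interval. Convexity there
  passes to the endpoints by continuity, after all points are contracted slightly towards the
  midpoint.\<close>

lemma convex_on_Icc_if_deriv2_nonneg:
  fixes g :: "real \<Rightarrow> real"
  assumes cont: "continuous_on {a..b} g"
    and g': "\<And>x. x \<in> {a<..<b} \<Longrightarrow> (g has_real_derivative g' x) (at x)"
    and g'': "\<And>x. x \<in> {a<..<b} \<Longrightarrow> (g' has_real_derivative g'' x) (at x)"
    and nonneg: "\<And>x. x \<in> {a<..<b} \<Longrightarrow> 0 \<le> g'' x"
  shows "convex_on {a..b} g"
proof (cases "a < b")
  case True
  have conv: "convex_on {a<..<b} g"
    by (rule f''_ge0_imp_convex[OF _ g' g'' nonneg]) auto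
  define m where "m = (a + b) / 2"
  \<comment> \<open>\<open>P s\<close> is the contraction towards \<open>m\<close> with ratio
    \<open>1 - s\<close>. For \<open>0 < s < 1\<close> it maps \<open>{a..b}\<close> into the open
    interval, and as \<open>s\<close> tends to 0 it tends to the identity.\<close>
  define P where "P s z = z + s * (m - z)" for s z
  have P_in: "P s z \<in> {a<..<b}" if "z \<in> {a..b}" "s \<in> {0<..<1}" for s z
  proof -
    have "P s z = (1 - s) * z + s * m" by (simp add: P_def algebra_simps)
    moreover have "(1 - s) * a \<le> (1 - s) * z" "(1 - s) * z \<le> (1 - s) * b" "s * a < s * m" "s * m < s * b"
      using that True by (auto simp: m_def)
    ultimately show ?thesis by (auto simp: algebra_simps)
  qed
  have lim: "((\<lambda>s. g (P s z)) \<longlongrightarrow> g z) (at_right 0)" if z: "z \<in> {a..b}" for z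
  proof -
    have "((\<lambda>s. P s z) \<longlongrightarrow> P 0 z) (at_right 0)"
      unfolding P_def by (intro tendsto_intros)
    moreover have "\<forall>\<^sub>F s in at_right 0. P s z \<in> {a..b}"
      using P_in[OF z] unfolding eventually_at_right_field
      by (intro exI[of _ 1]) (auto simp: less_imp_le)
    ultimately show ?thesis
      using continuous_on_tendsto_compose[OF cont, of "\<lambda>s. P s z" z "at_right 0"] z
      by (simp add: P_def)
  qed
  show ?thesis
    unfolding convex_on_def
  proof (intro conjI ballI allI impI)
    fix x y u v :: real
    assume xy: "x \<in> {a..b}" "y \<in> {a..b}" and uv: "0 \<le> u" "0 \<le> v" "u + v = 1"
    have z: "u * x + v * y \<in> {a..b}"
      using convexD[OF convex_real_interval(5) xy uv] by simp
    have "g (u * x + v * y) \<le> u * g x + v * g y"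
    proof (rule tendsto_le[OF _ _ lim[OF z]])
      show "((\<lambda>s. u * g (P s x) + v * g (P s y)) \<longlongrightarrow> u * g x + v * g y) (at_right 0)"
        by (intro tendsto_intros lim xy)
      have "g (P s (u * x + v * y)) \<le> u * g (P s x) + v * g (P s y)" if s: "s \<in> {0<..<1}" for s
      proof -
        \<comment> \<open>\<open>P s\<close> is affine, hence commutes with convex
          combinations.\<close>
        have "P s (u * x + v * y) = u * P s x + v * P s y"
          using uv(3) unfolding P_def by algebra
        then show ?thesis
          using conv P_in[OF xy(1) s] P_in[OF xy(2) s] uv unfolding convex_on_def by auto
      qed
      then show "\<forall>\<^sub>F s in at_right 0. g (P s (u * x + v * y)) \<le> u * g (P s x) + v * g (P s y)"
        unfolding eventually_at_right_field by (intro exI[of _ 1]) auto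
    qed simp
    then show "g (u *\<^sub>R x + v *\<^sub>R y) \<le> u * g x + v * g y" by simp
  qed simp
next
  case False
  then have "{a..b} \<subseteq> {a}" by auto
  moreover have "convex_on {a} g"
    unfolding convex_on_def by (auto simp flip: distrib_right)
  ultimately show ?thesis using convex_on_subset[of "{a}" g "{a..b}"] by simp
qed

section \<open>Partial derivatives at interior points\<close>

lemma partial_D_derivative_y:
  assumes f: "f \<in> C_square r s a b" and "j < s" "x \<in> {a..b}" "y \<in> {a<..<b}"
  shows "((\<lambda>t. partial_D a b 0 j f (x, t)) has_real_derivative partial_D a b 0 (Suc j) f (x, y)) (at y)"
proof -
  \<comment> \<open>In the interior the derivative within \<open>{a..b}\<close> is the ordinary
    two-sided one.\<close>
  have at: "at y within {a..b} = at y"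
    using assms(4) by (intro at_within_interior) auto
  have "(\<lambda>t. partial_D a b 0 j f (x, t)) differentiable (at y within {a..b})"
    using f assms(2-4) unfolding C_square_def by auto
  then show ?thesis
    unfolding at vector_derivative_works has_real_derivative_iff_has_vector_derivative
    by (simp add: partial_D_def partial_y_def at)
qed

lemma partial_D_derivative_x:
  assumes f: "f \<in> C_square r s a b" and "i < r" "j \<le> s" "x \<in> {a<..<b}" "y \<in> {a..b}"
  shows "((\<lambda>t. partial_D a b i j f (t, y)) has_real_derivative partial_D a b (Suc i) j f (x, y)) (at x)"
proof -
  have at: "at x within {a..b} = at x"
    using assms(4) by (intro at_within_interior) auto
  have "(\<lambda>t. partial_D a b i j f (t, y)) differentiable (at x within {a..b})"
    using f assms(2-5) unfolding C_square_def by auto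
  then show ?thesis
    unfolding at vector_derivative_works has_real_derivative_iff_has_vector_derivative
    by (simp add: partial_D_def partial_x_def at)
qed

lemma C_square_continuous:
  assumes "f \<in> C_square r s a b"
  shows "continuous_on ({a..b} \<times> {a..b}) f"
proof -
  have "continuous_on ({a..b} \<times> {a..b}) (partial_D a b 0 0 f)"
    using assms unfolding C_square_def by blast
  then show ?thesis by (simp add: partial_D_def)
qed

text \<open>
  The \<open>y\<close>-derivatives are taken first because \<open>partial_D\<close> applies them first; thus no commutation of
  partial derivatives is needed.
\<close>

lemma biconvex_if_partial_D:
  assumes f: "f \<in> C_square 2 2 a b"
    and sgn: "\<And>p. p \<in> {a<..<b} \<times> {a<..<b} \<Longrightarrow> 0 \<le> c * partial_D a b 2 2 f p"
  shows "biconvex a b (\<lambda>p. c * f p)"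
  unfolding biconvex_def
proof (intro ballI allI impI)
  fix x z u v :: real
  assume xz: "x \<in> {a..b}" "z \<in> {a..b}" and uv: "0 \<le> u" "0 \<le> v" "u + v = 1"
  have m: "u * x + v * z \<in> {a..b}"
    using convexD[OF convex_real_interval(5) xz uv] by simp
  \<comment> \<open>\<open>G 0\<close> is the convexity defect in \<open>x\<close> of
    \<open>c * f\<close>, and \<open>G j\<close> is its \<open>j\<close>-th derivative in
    \<open>y\<close>. The goal is convexity of \<open>G 0\<close>, so \<open>G 2\<close> has to be
    nonnegative.\<close>
  define G where
    "G j y = u * (c * partial_D a b 0 j f (x, y)) + v * (c * partial_D a b 0 j f (z, y))
       - c * partial_D a b 0 j f (u * x + v * z, y)" for j y
  have G': "(G j has_real_derivative G (Suc j) y) (at y)" if "j < 2" "y \<in> {a<..<b}" for j y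
    unfolding G_def
    by (intro DERIV_diff DERIV_add DERIV_cmult partial_D_derivative_y[OF f that(1) _ that(2)] xz m)
  have G2: "0 \<le> G 2 y" if y: "y \<in> {a<..<b}" for y
  proof -
    have y': "y \<in> {a..b}" using y by auto
    have "continuous_on ({a..b} \<times> {a..b}) (partial_D a b 0 2 f)"
      using f unfolding C_square_def by blast
    then have cont: "continuous_on {a..b} (\<lambda>t. partial_D a b 0 2 f (t, y))"
      by (rule continuous_on_sections(2)) (use y' in auto)
    \<comment> \<open>\<open>G 2 y\<close> is the convexity defect of this function. Convexity is
      needed on the closed interval because \<open>x\<close> and \<open>z\<close> may be
      endpoints.\<close>
    have "convex_on {a..b} (\<lambda>t. c * partial_D a b 0 2 f (t, y))"
    proof (rule convex_on_Icc_if_deriv2_nonneg)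
      fix t assume t: "t \<in> {a<..<b}"
      show "((\<lambda>t. c * partial_D a b 0 2 f (t, y)) has_real_derivative c * partial_D a b (Suc 0) 2 f (t, y)) (at t)"
        by (intro DERIV_cmult partial_D_derivative_x[OF f _ _ t y']) auto
      show "((\<lambda>t. c * partial_D a b (Suc 0) 2 f (t, y)) has_real_derivative c * partial_D a b (Suc (Suc 0)) 2 f (t, y)) (at t)"
        by (intro DERIV_cmult partial_D_derivative_x[OF f _ _ t y']) auto
      show "0 \<le> c * partial_D a b (Suc (Suc 0)) 2 f (t, y)"
        using sgn[of "(t, y)"] t y by (simp add: numeral_2_eq_2)
    qed (intro continuous_intros cont)
    then show ?thesis
      using xz uv unfolding convex_on_def G_def by simp
  qed
  have "continuous_on {a..b} (G 0)"
    unfolding G_def partial_D_def using xz m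
    by (auto intro!: continuous_intros continuous_on_sections(1)[OF C_square_continuous[OF f]])
  then have "convex_on {a..b} (G 0)"
    by (rule convex_on_Icc_if_deriv2_nonneg[where g' = "G 1" and g'' = "G 2"])
       (use G2 G'[of 0] G'[of 1] in \<open>auto simp: numeral_2_eq_2\<close>)
  then show "convex_on {a..b} (\<lambda>y. u * (c * f (x, y)) + v * (c * f (z, y)) - c * f (u * x + v * z, y))"
    unfolding G_def partial_D_def by simp
qed

subsection \<open>The modified product rule\<close>

text \<open>The remainder is I(x)I - Q(x)Q - M(x)(I - Q) - (I - Q)(x)M, where (x) denotes the tensor
  product. Substituting Q = I + T and M = I - N cancels the terms I(x)T and T(x)I, which is the
  purpose of the correction in \<open>modified_trapezium\<close>.\<close>

lemma modified_remainder_tensor: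
  fixes a b n
  defines "I \<equiv> integral {a..b}" and "Q \<equiv> trapezium_rule a b n" and "M \<equiv> midpoint_rule a b 1"
  defines "T \<equiv> \<lambda>g. 1 * Q g + (-1) * I g" and "N \<equiv> \<lambda>g. 1 * I g + (-1) * M g"
  assumes ab: "a \<le> b" "n \<ge> 1" and f: "continuous_on ({a..b} \<times> {a..b}) f"
  shows "modified_remainder a b n f = - (tensor T N f + tensor N T f + tensor T T f)"
proof -
  have lin: "linear_functional a b I" "linear_functional a b Q" "linear_functional a b M"
    unfolding I_def Q_def M_def
    using ab by (auto intro: linear_functional_integral linear_functional_trapezium linear_functional_midpoint)
  have linTN: "linear_functional a b T" "linear_functional a b N"
    unfolding T_def N_def by (intro linear_functional_lincomb lin)+
  have M: "M = (\<lambda>g. (b - a) * g ((a + b) / 2))"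
    by (simp add: M_def midpoint_rule_def step_def node_def fun_eq_iff)
  have mid: "(a + b) / 2 \<in> {a..b}" using ab by auto
  have "integral ({a..b} \<times> {a..b}) f = tensor I I f"
    using integral_prod_continuous[of a a b b f] f
    by (simp add: tensor_def I_def cbox_Pair_eq)
  moreover have "product_trapezium a b n f = tensor Q Q f"
    by (simp add: product_trapezium_def tensor_def Q_def trapezium_rule_def primed_sum_scale power2_eq_square)
  moreover have "(b - a) * trapezium_remainder a b n (\<lambda>t. f ((a + b) / 2, t)) = tensor M I f - tensor M Q f"
    by (simp add: M tensor_def trapezium_remainder_def I_def Q_def algebra_simps)
  moreover have "(b - a) * trapezium_remainder a b n (\<lambda>t. f (t, (a + b) / 2)) = tensor I M f - tensor Q M f"
    \<comment> \<open>Here \<open>M\<close> is the inner functional, so its factor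
      \<open>b - a\<close> has to be pulled out of \<open>I\<close> and \<open>Q\<close> by
      linearity.\<close>
    using linear_functional_scale[OF lin(1) continuous_on_sections(2)[OF f mid], of "b - a"]
      linear_functional_scale[OF lin(2) continuous_on_sections(2)[OF f mid], of "b - a"]
    by (simp add: M tensor_def trapezium_remainder_def I_def Q_def algebra_simps)
  ultimately have "modified_remainder a b n f =
      tensor I I f - tensor Q Q f - (tensor M I f - tensor M Q f) - (tensor I M f - tensor Q M f)"
    unfolding modified_remainder_def modified_trapezium_def by (simp add: distrib_left)
  moreover have "tensor T C f = tensor Q C f - tensor I C f" "tensor N C f = tensor I C f - tensor M C f" for C
    unfolding T_def N_def tensor_lincomb_left by simp_all
  moreover have "tensor A T f = tensor A Q f - tensor A I f" "tensor A N f = tensor A I f - tensor A M f"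
    if "linear_functional a b A" for A
    unfolding T_def N_def
    using tensor_lincomb_right[OF that lin(2,1) f, of 1 "-1"] tensor_lincomb_right[OF that lin(1,3) f, of 1 "-1"]
    by simp_all
  ultimately show ?thesis
    using lin by simp
qed

text \<open>Both remainders are nonpositive. With T = P + 2 U, the excess of -R[S_n] over -2 R[S_2n]
  is P(x)N + N(x)P + P(x)P + 2 P(x)U + 2 U(x)P + 2 U(x)U, and each of these products is nonnegative
  on \<open>f\<close>.\<close>

lemma modified_remainder_half:
  assumes ab: "a \<le> b" "n \<ge> 1" and f: "continuous_on ({a..b} \<times> {a..b}) f" "biconvex a b f"
  shows "\<bar>modified_remainder a b (2 * n) f\<bar> \<le> 1 / 2 * \<bar>modified_remainder a b n f\<bar>"
proof -
  define T where "T = (\<lambda>g. 1 * trapezium_rule a b n g + (-1) * integral {a..b} g)"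
  define U where "U = (\<lambda>g. 1 * trapezium_rule a b (2 * n) g + (-1) * integral {a..b} g)"
  define P where "P = (\<lambda>g. 1 * integral {a..b} g + (-1) * midpoint_rule a b n g)"
  define N where "N = (\<lambda>g. 1 * integral {a..b} g + (-1) * midpoint_rule a b 1 g)"
  have pos: "convex_positive a b U" "convex_positive a b P" "convex_positive a b N"
    unfolding U_def P_def N_def
    by (intro convex_positive_trapezium convex_positive_midpoint; use ab in simp)+
  then have lin: "linear_functional a b U" "linear_functional a b P" "linear_functional a b N"
    unfolding convex_positive_def by auto
  have T: "T = (\<lambda>g. 1 * P g + 2 * U g)"
    unfolding T_def P_def U_def trapezium_rule_double[OF ab(2)] by (simp add: fun_eq_iff field_simps)
  have R: "modified_remainder a b n f = - (tensor T N f + tensor N T f + tensor T T f)"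
    "modified_remainder a b (2 * n) f = - (tensor U N f + tensor N U f + tensor U U f)"
    unfolding T_def U_def N_def by (intro modified_remainder_tensor f; use ab in simp)+
  have right: "tensor A T f = tensor A P f + 2 * tensor A U f" if "linear_functional a b A" for A
    unfolding T using tensor_lincomb_right[OF that lin(2,1) f(1), of 1 2] by simp
  have left: "tensor T A f = tensor P A f + 2 * tensor U A f" for A
    unfolding T tensor_lincomb_left by simp
  note nonneg = tensor_nonneg[OF _ _ f]
  have "0 \<le> tensor U N f" "0 \<le> tensor N U f" "0 \<le> tensor U U f" "0 \<le> tensor P N f"
    "0 \<le> tensor N P f" "0 \<le> tensor P P f" "0 \<le> tensor P U f" "0 \<le> tensor U P f"
    by (intro nonneg pos)+
  then show ?thesis
    unfolding R left right[OF lin(1)] right[OF lin(2)] right[OF lin(3)]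
    by simp
qed

text \<open>Carries the estimate from \<open>c * f\<close> back to \<open>f\<close>; with
  \<open>c = -1\<close> this settles the case of a nonpositive mixed derivative.\<close>

lemma modified_remainder_scale:
  "modified_remainder a b n (\<lambda>p. c * f p) = c * modified_remainder a b n f"
  unfolding modified_remainder_def modified_trapezium_def product_trapezium_def
    trapezium_remainder_def trapezium_rule_def primed_sum_scale
  by (simp add: algebra_simps)

theorem theorem1:
  fixes a b :: real and n :: nat and f :: "real \<times> real \<Rightarrow> real"
  assumes "a < b" and "n \<ge> 1" and "f \<in> C22_const_sign a b"
  shows "\<bar>modified_remainder a b (2 * n) f\<bar> \<le> 1 / 2 * \<bar>modified_remainder a b n f\<bar> \<and>
         \<bar>modified_remainder a b (2 * n) f\<bar>
           \<le> \<bar>modified_trapezium a b (2 * n) f - modified_trapezium a b n f\<bar>"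
proof -
  have f: "f \<in> C_square 2 2 a b"
    using assms(3) unfolding C22_const_sign_def by blast
  have "\<exists>c. \<bar>c\<bar> = 1 \<and> (\<forall>p\<in>{a<..<b} \<times> {a<..<b}. 0 \<le> c * partial_D a b 2 2 f p)"
    using assms(3) unfolding C22_const_sign_def
    by (auto intro: exI[of _ "1::real"] exI[of _ "-1::real"])
  then obtain c :: real where c: "\<bar>c\<bar> = 1"
    and sgn: "\<And>p. p \<in> {a<..<b} \<times> {a<..<b} \<Longrightarrow> 0 \<le> c * partial_D a b 2 2 f p"
    by blast
  have "\<bar>modified_remainder a b (2 * n) (\<lambda>p. c * f p)\<bar> \<le> 1 / 2 * \<bar>modified_remainder a b n (\<lambda>p. c * f p)\<bar>"
    using assms(1,2)
    by (intro modified_remainder_half biconvex_if_partial_D[OF f sgn] continuous_intros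
        C_square_continuous[OF f]) auto
  then have half: "\<bar>modified_remainder a b (2 * n) f\<bar> \<le> 1 / 2 * \<bar>modified_remainder a b n f\<bar>"
    using c by (simp add: modified_remainder_scale abs_mult)
  \<comment> \<open>The exact integral cancels. Then |R[S_n] - R[S_2n]| \<ge> |R[S_n]| - |R[S_2n]|
    \<ge> |R[S_2n]|, the last step by \<open>half\<close>.\<close>
  moreover have "modified_trapezium a b (2 * n) f - modified_trapezium a b n f =
      modified_remainder a b n f - modified_remainder a b (2 * n) f"
    unfolding modified_remainder_def by simp
  ultimately show ?thesis by linarith
qed

end
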